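(* For every integer $k\geq 2$, let $x^k$ denote the unary pattern consisting of the variable $x$ repeated $k$ times. Then $\lambda_\simeq(x^k)=3$ if $k\in\{2,3\}$, and $\lambda_\simeq(x^k)=2$ if $k\geq 4$.
   Context: For a word $u=u_1\cdots u_n$ (letters $u_i$), its reversal is $u^R=u_n\cdots u_1$. Let $\simeq$ be the equivalence relation on words with $u\simeq u'$ iff $u'=u$ or $u'=u^R$. A pattern is a word $p=p_1\cdots p_n$ over an alphabet of variables. A word $w$ encounters $p$ up to $\simeq$ if $w$ has a factor $X_1X_2\cdots X_n$ where each $X_i$ is a nonempty word and $X_i\simeq X_j$ whenever $p_i=p_j$; otherwise $w$ avoids $p$ up to $\simeq$. The pattern $p$ is $k$-avoidable up to $\simeq$ if some infinite word over a $k$-letter alphabet avoids $p$ up to $\simeq$. The avoidability index $\lambda_\simeq(p)$ is the least positive integer $k$ such that $p$ is $k$-avoidable up to $\simeq$ (or $\infty$ if there is none). *)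

theory Defs
  imports Main "HOL-Library.Extended_Nat"
begin

definition rev_equiv :: "'a list \<Rightarrow> 'a list \<Rightarrow> bool"  (infix \<open>\<simeq>\<close> 50) where
  "u \<simeq> u' \<longleftrightarrow> u' = u \<or> u' = rev u"

text \<open>Infinite words are functions on the natural numbers; patterns are lists of variables.\<close>

definition factor_of :: "'a list \<Rightarrow> (nat \<Rightarrow> 'a) \<Rightarrow> bool" where
  "factor_of u w \<longleftrightarrow> (\<exists>i. u = map w [i..<i + length u])"

definition encounters :: "(nat \<Rightarrow> 'a) \<Rightarrow> 'v list \<Rightarrow> bool" where
  "encounters w p \<longleftrightarrow>
     (\<exists>Xs. length Xs = length p
         \<and> (\<forall>i < length p. Xs ! i \<noteq> [])
         \<and> (\<forall>i < length p. \<forall>j < length p. p ! i = p ! j \<longrightarrow> Xs ! i \<simeq> Xs ! j)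
         \<and> factor_of (concat Xs) w)"

definition avoids :: "(nat \<Rightarrow> 'a) \<Rightarrow> 'v list \<Rightarrow> bool" where
  "avoids w p \<longleftrightarrow> \<not> encounters w p"

text \<open>The \<open>k\<close>-letter alphabet is taken to be \<open>{0, \<dots>, k - 1}\<close>.\<close>

definition avoidable :: "nat \<Rightarrow> 'v list \<Rightarrow> bool" where
  "avoidable k p \<longleftrightarrow> (\<exists>w :: nat \<Rightarrow> nat. range w \<subseteq> {..<k} \<and> avoids w p)"

text \<open>The infimum of the empty set in \<^typ>\<open>enat\<close> is \<open>\<infinity>\<close>.\<close>

definition avoidability_index :: "'v list \<Rightarrow> enat" where
  "avoidability_index p = Inf {enat k | k. 0 < k \<and> avoidable k p}"

end

theory Submission
  imports Defs "HOL-Library.Sublist"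
begin

text \<open>
  Since \<open>X X\<^sup>R\<close> contains the square of a letter, every square-free word avoids \<open>x x\<close> up to
  reversal, and the differences of the Thue--Morse word form a ternary one.

  In a binary word without cubes up to reversal, two adjacent letters are never followed by an
  equal third, and positions \<open>i\<close>, \<open>i + 2\<close>, \<open>i + 4\<close> are never all followed by a change of letter.
  This forces the changes to recur with period 3, and two of them per period cancel, so that the
  word itself has period 3.

  The fourth power is avoided by the paperfolding word. A shift by \<open>2 * q\<close> with \<open>q\<close> odd flips its
  letters at odd positions. If four blocks of odd length \<open>p\<close> agree up to reversal, then so do
  their middle letters, two of which are at odd positions a distance \<open>2 * p\<close> apart. The word
  has no square of even period either, because passing to the even positions halves the period
  until it is \<open>2 * q\<close> with \<open>q\<close> odd. So four blocks of even length that agree up to reversal would have to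
  alternate, and this again makes a square of even period.
\<close>

section \<open>Blocks\<close>

definition block :: "(nat \<Rightarrow> 'a) \<Rightarrow> nat \<Rightarrow> nat \<Rightarrow> 'a list" where
  "block w a n = map w [a..<a + n]"

lemma length_block [simp]: "length (block w a n) = n"
  by (simp add: block_def)

lemma nth_block [simp]: "i < n \<Longrightarrow> block w a n ! i = w (a + i)"
  by (simp add: block_def)

lemma block_0 [simp]: "block w a 0 = []"
  by (simp add: block_def)

lemma block_Suc: "block w a (Suc n) = w a # block w (Suc a) n"
  by (simp add: block_def upt_conv_Cons del: upt_Suc)

lemma map_block: "map f (block w a n) = block (f \<circ> w) a n"
  by (simp add: block_def)

lemma block_add: "block w a (m + n) = block w a m @ block w (a + m) n"
  unfolding block_def by (metis add.assoc le_add1 map_append upt_add_eq_append)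

lemma block_eq_iff: "block w a n = block v b n \<longleftrightarrow> (\<forall>i<n. w (a + i) = v (b + i))"
  by (auto simp: list_eq_iff_nth_eq)

lemma append_eq_block_iff:
  "u @ v = block w a n \<longleftrightarrow>
     u = block w a (length u) \<and> v = block w (a + length u) (length v) \<and> length u + length v = n"
proof
  assume append: "u @ v = block w a n"
  then have length: "length u + length v = n"
    by (metis length_append length_block)
  with append have "u @ v = block w a (length u) @ block w (a + length u) (length v)"
    by (simp flip: block_add)
  with length show "u = block w a (length u) \<and> v = block w (a + length u) (length v)
      \<and> length u + length v = n"
    by simp
next
  assume "u = block w a (length u) \<and> v = block w (a + length u) (length v)
    \<and> length u + length v = n"
  then show "u @ v = block w a n"
    using block_add[of w a "length u" "length v"] by simp
qed

lemma concat_blocks: "concat (map (\<lambda>i. block w (a + i * p) p) [0..<k]) = block w a (k * p)"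
  by (induction k) (simp_all add: block_add add.commute[of p])

lemma nth_of_concat_eq_block:
  assumes "concat Xs = block w a n" and "i < length Xs"
  shows "Xs ! i = block w (a + length (concat (take i Xs))) (length (Xs ! i))"
proof -
  have "concat (take i Xs) @ Xs ! i @ concat (drop (Suc i) Xs) = block w a n"
    using assms by (metis concat.simps(2) concat_append id_take_nth_drop)
  then show ?thesis
    by (simp add: append_eq_block_iff)
qed

lemma length_concat_uniform:
  assumes "\<forall>X\<in>set Xs. length X = p"
  shows "length (concat Xs) = length Xs * p"
  using assms by (induction Xs) simp_all


section \<open>Encountering patterns up to reversal\<close>

lemma rev_equiv_refl [simp]: "u \<simeq> u"
  by (simp add: rev_equiv_def)

lemma rev_equiv_sym: "u \<simeq> v \<Longrightarrow> v \<simeq> u"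
  by (auto simp: rev_equiv_def)

lemma rev_equiv_trans: "u \<simeq> v \<Longrightarrow> v \<simeq> t \<Longrightarrow> u \<simeq> t"
  by (auto simp: rev_equiv_def)

lemma rev_equiv_map: "u \<simeq> v \<Longrightarrow> map f u \<simeq> map f v"
  by (auto simp: rev_equiv_def rev_map)

lemma rev_equiv_length: "u \<simeq> v \<Longrightarrow> length u = length v"
  by (auto simp: rev_equiv_def)

lemma rev_equiv_nth_middle:
  assumes "u \<simeq> v" and "length u = 2 * m + 1"
  shows "u ! m = v ! m"
  using assms by (auto simp: rev_equiv_def rev_nth)

lemma factor_of_iff_block: "factor_of u w \<longleftrightarrow> (\<exists>a. u = block w a (length u))"
  by (simp add: factor_of_def block_def)

lemma factor_of_sublist:
  assumes "factor_of u w" and "sublist v u"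
  shows "factor_of v w"
  using assms unfolding sublist_def factor_of_iff_block
  by (metis append_eq_block_iff)

lemma factor_of_map: "factor_of u w \<Longrightarrow> factor_of (map f u) (f \<circ> w)"
  unfolding factor_of_iff_block by (metis length_map map_block)

lemma sublist_concat: "sublist Xs Ys \<Longrightarrow> sublist (concat Xs) (concat Ys)"
  unfolding sublist_def by (metis concat_append)

lemma encounters_sublist:
  assumes "encounters w q" and "sublist p q"
  shows "encounters w p"
proof -
  obtain ps ss where q: "q = ps @ p @ ss"
    using assms(2) by (auto simp: sublist_def)
  obtain Xs where len: "length Xs = length q"
    and ne: "\<forall>i<length q. Xs ! i \<noteq> []"
    and equiv: "\<forall>i<length q. \<forall>j<length q. q ! i = q ! j \<longrightarrow> Xs ! i \<simeq> Xs ! j"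
    and factor: "factor_of (concat Xs) w"
    using assms(1) by (auto simp: encounters_def)
  define Ys where "Ys = take (length p) (drop (length ps) Xs)"
  have "length Ys = length p"
    using len by (simp add: Ys_def q)
  moreover have "Ys ! i = Xs ! (length ps + i)" "p ! i = q ! (length ps + i)"
    "length ps + i < length q" if "i < length p" for i
    using that len by (simp_all add: Ys_def q nth_append)
  moreover have "factor_of (concat Ys) w"
    using factor unfolding Ys_def
    by (metis factor_of_sublist sublist_concat sublist_drop sublist_order.order_trans sublist_take)
  ultimately show ?thesis
    unfolding encounters_def using ne equiv by (intro exI[of _ Ys]) simp
qed

lemma encounters_comp:
  assumes "encounters w p"
  shows "encounters (f \<circ> w) p"
proof -
  obtain Xs where "length Xs = length p" "\<forall>i<length p. Xs ! i \<noteq> []"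
    "\<forall>i<length p. \<forall>j<length p. p ! i = p ! j \<longrightarrow> Xs ! i \<simeq> Xs ! j" "factor_of (concat Xs) w"
    using assms by (auto simp: encounters_def)
  then show ?thesis
    unfolding encounters_def using factor_of_map[of "concat Xs" w f]
    by (intro exI[of _ "map (map f) Xs"]) (simp add: map_concat rev_equiv_map)
qed

lemma encounters_const: "encounters (\<lambda>_. c) p"
proof -
  have "concat (map (\<lambda>_. [c]) p) = block (\<lambda>_. c) 0 (length p)"
    by (rule nth_equalityI) (simp_all add: concat_map_singleton)
  then show ?thesis
    unfolding encounters_def factor_of_iff_block
    by (intro exI[of _ "map (\<lambda>_. [c]) p"]) (auto intro: exI[of _ 0])
qed

lemma encounters_replicate_iff:
  "encounters w (replicate k x) \<longleftrightarrow> (\<exists>a p. p > 0 \<and> (\<forall>i<k. block w a p \<simeq> block w (a + i * p) p))"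
    (is "?L \<longleftrightarrow> ?R")
proof
  assume ?L
  then obtain Xs a where len: "length Xs = k" and ne: "\<forall>i<k. Xs ! i \<noteq> []"
    and equiv: "\<forall>i<k. \<forall>j<k. Xs ! i \<simeq> Xs ! j"
    and factor: "concat Xs = block w a (length (concat Xs))"
    by (auto simp: encounters_def factor_of_iff_block)
  define p where "p = length (Xs ! 0)"
  have nth_length: "length (Xs ! i) = p" if "i < k" for i
    using equiv that by (auto simp: p_def intro: rev_equiv_length)
  have "Xs ! i = block w (a + i * p) p" if "i < k" for i
  proof -
    have "\<forall>X\<in>set (take i Xs). length X = p"
      using nth_length len that by (auto simp: in_set_conv_nth)
    then have "length (concat (take i Xs)) = i * p"
      using length_concat_uniform[of "take i Xs"] len that by simp
    then show ?thesis
      using nth_of_concat_eq_block[OF factor, of i] nth_length that len by simp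
  qed
  then have "block w a p \<simeq> block w (a + i * p) p" if "i < k" for i
    using equiv that by (metis add_0_right gr_zeroI mult_0 not_less0)
  moreover have "p > 0" if "k > 0"
    using ne that by (simp add: p_def)
  ultimately show ?R
    by (cases "k = 0") auto
next
  assume ?R
  then obtain a p where p: "p > 0" and equiv: "\<And>i. i < k \<Longrightarrow> block w a p \<simeq> block w (a + i * p) p"
    by blast
  let ?Xs = "map (\<lambda>i. block w (a + i * p) p) [0..<k]"
  have "factor_of (concat ?Xs) w"
    by (auto simp: concat_blocks factor_of_iff_block)
  moreover have "?Xs ! i \<noteq> []" if "i < k" for i
    using that p by (simp flip: length_greater_0_conv)
  moreover have "?Xs ! i \<simeq> ?Xs ! j" if "i < k" "j < k" for i j
    using equiv that by (auto intro: rev_equiv_trans rev_equiv_sym)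
  ultimately show ?L
    unfolding encounters_def by (intro exI[of _ ?Xs]) simp
qed


section \<open>Avoidability\<close>

lemma avoids_sublist: "avoids w p \<Longrightarrow> sublist p q \<Longrightarrow> avoids w q"
  unfolding avoids_def using encounters_sublist by blast

lemma avoids_comp_inj_on:
  assumes "avoids w p" and "inj_on f (range w)"
  shows "avoids (f \<circ> w) p"
proof -
  have "inv_into (range w) f \<circ> (f \<circ> w) = w"
    using assms(2) by (auto simp: fun_eq_iff)
  then show ?thesis
    using assms(1) encounters_comp unfolding avoids_def by metis
qed

lemma avoiding_word_transfer:
  assumes "finite A" "finite B" "card A \<le> card B" and "range w \<subseteq> A" "avoids w p"
  shows "\<exists>v. range v \<subseteq> B \<and> avoids v p"
proof -
  obtain f where "inj_on f A" "f ` A \<subseteq> B"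
    using assms(3) inj_on_iff_card_le[OF assms(1,2)] by blast
  then have "range (f \<circ> w) \<subseteq> B" "avoids (f \<circ> w) p"
    using assms(4,5) by (auto intro: avoids_comp_inj_on inj_on_subset)
  then show ?thesis by blast
qed

lemma avoidable_card_iff:
  assumes "finite A"
  shows "avoidable (card A) p \<longleftrightarrow> (\<exists>w. range w \<subseteq> A \<and> avoids w p)"
  unfolding avoidable_def using avoiding_word_transfer[of "{..<card A}" A]
    avoiding_word_transfer[of A "{..<card A}"] assms by auto

lemma avoidable_sublist: "avoidable n p \<Longrightarrow> sublist p q \<Longrightarrow> avoidable n q"
  unfolding avoidable_def using avoids_sublist by blast

lemma avoidable_mono: "avoidable m p \<Longrightarrow> m \<le> n \<Longrightarrow> avoidable n p"
  unfolding avoidable_def by (meson lessThan_subset_iff subset_trans)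

lemma avoidable_replicate_mono:
  assumes "avoidable n (replicate k x)" and "k \<le> l"
  shows "avoidable n (replicate l x)"
proof -
  have "replicate l x = replicate k x @ replicate (l - k) x"
    using assms(2) by (simp flip: replicate_add)
  then show ?thesis
    using assms(1) avoidable_sublist by (metis sublist_append_rightI)
qed

lemma not_avoidable_1: "\<not> avoidable 1 p"
proof
  assume "avoidable 1 p"
  then obtain w :: "nat \<Rightarrow> nat" where "range w \<subseteq> {..<1}" "avoids w p"
    by (auto simp: avoidable_def)
  moreover from this have "w = (\<lambda>_. 0)" by auto
  ultimately show False
    by (simp add: avoids_def encounters_const)
qed

lemma avoidability_index_eqI:
  assumes "avoidable (Suc n) p" and "\<not> avoidable n p"
  shows "avoidability_index p = enat (Suc n)"
  unfolding avoidability_index_def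
proof (rule Inf_eqI)
  fix m
  assume "m \<in> {enat k |k. 0 < k \<and> avoidable k p}"
  then obtain k where "m = enat k" "avoidable k p" by blast
  then show "enat (Suc n) \<le> m"
    using assms(2) avoidable_mono[of k p n] not_less_eq_eq by fastforce
qed (use assms(1) in auto)


section \<open>Cubes in binary words\<close>

theorem binary_word_encounters_cube:
  fixes w :: "nat \<Rightarrow> bool"
  shows "encounters w (replicate 3 x)"
proof (rule ccontr)
  assume not_encounters: "\<not> encounters w (replicate 3 x)"
  have no_cube: False
    if "p > 0" "block w a p \<simeq> block w (a + p) p" "block w a p \<simeq> block w (a + 2 * p) p" for a p
  proof -
    have "\<forall>i<3. block w a p \<simeq> block w (a + i * p) p"
      using that(2,3) by (simp add: numeral_3_eq_3 All_less_Suc mult_2)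
    with not_encounters \<open>p > 0\<close> show False
      unfolding encounters_replicate_iff by blast
  qed
  define change where "change i \<longleftrightarrow> w i \<noteq> w (i + 1)" for i
  have no_two_repeats: "change i \<or> change (i + 1)" for i
    using no_cube[of 1 i] by (auto simp: change_def rev_equiv_def block_Suc)
  have not_three_changes: "\<not> (change i \<and> change (i + 2) \<and> change (i + 4))" for i
    using no_cube[of 2 i] by (auto simp: change_def rev_equiv_def numeral_eq_Suc block_Suc)
  have period: "change (i + 1) \<and> change (i + 2) \<and> \<not> change (i + 3)" if "\<not> change i" "i > 0" for i
  proof -
    have "change (i - 1)" "change (i + 1)"
      using no_two_repeats[of "i - 1"] no_two_repeats[of i] that by auto
    moreover from this have "\<not> change (i + 3)"
      using not_three_changes[of "i - 1"] \<open>i > 0\<close> by (simp add: numeral_eq_Suc)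
    ultimately show ?thesis
      using no_two_repeats[of "i + 2"] by (simp add: numeral_eq_Suc)
  qed
  obtain i where "\<not> change i" "i > 0"
    using not_three_changes[of 1] by auto
  then have "block w i 3 = block w (i + 3) 3" "block w i 3 = block w (i + 6) 3"
    using period[of i] period[of "i + 3"] period[of "i + 6"]
    by (auto simp: change_def numeral_eq_Suc block_Suc)
  then show False
    using no_cube[of 3 i] by simp
qed

corollary not_avoidable_2_cube: "\<not> avoidable 2 (replicate 3 x)"
  using avoidable_card_iff[of "UNIV :: bool set" "replicate 3 x"]
  by (simp add: avoids_def binary_word_encounters_cube)


section \<open>The ternary Thue word\<close>

definition square_free :: "(nat \<Rightarrow> 'a) \<Rightarrow> bool" where
  "square_free w \<longleftrightarrow> (\<forall>a p. p > 0 \<longrightarrow> block w a p \<noteq> block w (a + p) p)"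

definition overlap_free :: "(nat \<Rightarrow> 'a) \<Rightarrow> bool" where
  "overlap_free w \<longleftrightarrow> (\<forall>a p. p > 0 \<longrightarrow> block w a (Suc p) \<noteq> block w (a + p) (Suc p))"

lemma square_free_imp_avoids_square:
  assumes "square_free w"
  shows "avoids w (replicate 2 x)"
  unfolding avoids_def encounters_replicate_iff
proof safe
  fix a p :: nat
  assume "p > 0" and equiv: "\<forall>i<2. block w a p \<simeq> block w (a + i * p) p"
  have "block w a p \<simeq> block w (a + p) p"
    using equiv[rule_format, of 1] by simp
  moreover have "block w a p \<noteq> block w (a + p) p"
    using assms \<open>p > 0\<close> by (simp add: square_free_def)
  ultimately have "block w (a + p) p = rev (block w a p)"
    by (simp add: rev_equiv_def eq_commute)
  then have "block w (a + p) p ! 0 = block w a p ! (p - 1)"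
    using \<open>p > 0\<close> by (simp add: rev_nth)
  then have "block w (a + (p - 1)) 1 = block w (a + (p - 1) + 1) 1"
    using \<open>p > 0\<close> by (simp add: block_eq_iff)
  then show False
    using assms unfolding square_free_def by (metis zero_less_one)
qed

lemma square_free_differences:
  fixes t :: "nat \<Rightarrow> bool"
  assumes "overlap_free t"
  shows "square_free (\<lambda>n. of_bool (t (Suc n)) - of_bool (t n) :: int)" (is "square_free ?d")
  unfolding square_free_def
proof (intro allI impI notI)
  fix a p :: nat
  assume "p > 0" and "block ?d a p = block ?d (a + p) p"
  then have eq: "?d (a + i) = ?d (a + p + i)" if "i < p" for i
    using that by (simp add: block_eq_iff)
  define T :: "nat \<Rightarrow> int" where "T n = of_bool (t n)" for n
  have sum_d: "(\<Sum>i<n. ?d (b + i)) = T (b + n) - T b" for b n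
    using sum_lessThan_telescope[of "\<lambda>i. T (b + i)" n] by (simp add: T_def)
  have shift: "T (a + p + n) - T (a + p) = T (a + n) - T a" if "n \<le> p" for n
    using that eq by (auto simp flip: sum_d intro!: sum.cong)
  \<comment> \<open>The increment \<open>T (a + p) - T a\<close> occurs twice in a row, but \<open>T\<close> takes only the values 0 and 1.\<close>
  have "T (a + p) = T a"
    using shift[of p] by (simp add: T_def of_bool_def split: if_splits)
  with shift have "block t a (Suc p) = block t (a + p) (Suc p)"
    by (simp add: block_eq_iff T_def of_bool_eq_iff less_Suc_eq_le)
  then show False
    using assms \<open>p > 0\<close> by (simp add: overlap_free_def)
qed

fun thue_morse :: "nat \<Rightarrow> bool" where
  "thue_morse n = (if n = 0 then False else thue_morse (n div 2) \<noteq> odd n)"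

declare thue_morse.simps [simp del]

lemma thue_morse_div_2: "thue_morse n \<longleftrightarrow> thue_morse (n div 2) \<noteq> odd n"
  by (cases "n = 0") (simp_all add: thue_morse.simps[of n])

lemma thue_morse_Suc_even: "even n \<Longrightarrow> thue_morse (Suc n) \<longleftrightarrow> \<not> thue_morse n"
  using thue_morse_div_2[of n] thue_morse_div_2[of "Suc n"] by simp

lemma thue_morse_overlap_halve:
  assumes "block thue_morse a (2 * p + 1) = block thue_morse (a + 2 * p) (2 * p + 1)"
  shows "block thue_morse (a div 2) (p + 1) = block thue_morse (a div 2 + p) (p + 1)"
  unfolding block_eq_iff
proof (intro allI impI)
  fix i
  assume "i < p + 1"
  then have "thue_morse (a + 2 * i) = thue_morse (a + 2 * (p + i))"
    using assms by (simp add: block_eq_iff add.assoc)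
  moreover have "thue_morse (a + 2 * j) \<longleftrightarrow> thue_morse (a div 2 + j) \<noteq> odd a" for j
    using thue_morse_div_2[of "a + 2 * j"] by (simp add: add.commute)
  ultimately show "thue_morse (a div 2 + i) = thue_morse (a div 2 + p + i)"
    by (metis add.assoc)
qed

lemma thue_morse_no_odd_overlap:
  assumes "odd p"
  shows "block thue_morse a (p + 1) \<noteq> block thue_morse (a + p) (p + 1)"
proof
  assume "block thue_morse a (p + 1) = block thue_morse (a + p) (p + 1)"
  then have eq: "thue_morse (a + i) = thue_morse (a + p + i)" if "i \<le> p" for i
    using that by (simp add: block_eq_iff less_Suc_eq_le)
  \<comment> \<open>One of \<open>a + i\<close> and \<open>a + p + i\<close> is even, so the word alternates on the whole period.\<close>
  have "thue_morse (Suc (a + i)) \<longleftrightarrow> \<not> thue_morse (a + i)" if "i < p" for i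
    using thue_morse_Suc_even[of "a + i"] thue_morse_Suc_even[of "a + p + i"]
      eq[of i] eq[of "Suc i"] that assms by auto
  then have "thue_morse (a + i) \<longleftrightarrow> (thue_morse a \<longleftrightarrow> even i)" if "i \<le> p" for i
    using that by (induction i) auto
  from this[of p] eq[of 0] show False
    using assms by simp
qed

theorem overlap_free_thue_morse: "overlap_free thue_morse"
proof -
  have "block thue_morse a (p + 1) \<noteq> block thue_morse (a + p) (p + 1)" if "p > 0" for a p
    using that
  proof (induction p arbitrary: a rule: less_induct)
    case (less p)
    show ?case
    proof (cases "even p")
      case True
      then obtain q where q: "p = 2 * q" by (elim evenE)
      then show ?thesis
        using less.IH[of q "a div 2"] less.prems thue_morse_overlap_halve[of a q] by auto
    next
      case False
      then show ?thesis by (rule thue_morse_no_odd_overlap)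
    qed
  qed
  then show ?thesis
    by (simp add: overlap_free_def)
qed

corollary avoidable_3_square: "avoidable 3 (replicate 2 x)"
proof -
  define thue :: "nat \<Rightarrow> int" where
    "thue n = of_bool (thue_morse (Suc n)) - of_bool (thue_morse n)" for n
  have "avoids thue (replicate 2 x)"
    unfolding thue_def
    by (intro square_free_imp_avoids_square square_free_differences overlap_free_thue_morse)
  moreover have "range thue \<subseteq> {-1, 0, 1}"
    by (auto simp: thue_def of_bool_def split: if_splits)
  ultimately have "avoidable (card {-1, 0, 1 :: int}) (replicate 2 x)"
    by (subst avoidable_card_iff) auto
  then show ?thesis by (simp add: numeral_3_eq_3)
qed


section \<open>The paperfolding word\<close>

text \<open>The paperfolding word proper starts at position 1; the letter at position 0 is arbitrary.\<close>

fun paperfolding :: "nat \<Rightarrow> bool" where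
  "paperfolding n = (if n = 0 then False else if odd n then n mod 4 = 3 else paperfolding (n div 2))"

declare paperfolding.simps [simp del]

lemma paperfolding_odd: "odd n \<Longrightarrow> paperfolding n \<longleftrightarrow> n mod 4 = 3"
  by (subst paperfolding.simps) auto

lemma paperfolding_double: "paperfolding (2 * n) = paperfolding n"
  by (cases "n = 0") (simp_all add: paperfolding.simps[of "2 * n"])

lemma paperfolding_add_double_odd:
  assumes "odd n" and "odd q"
  shows "paperfolding (n + 2 * q) \<longleftrightarrow> \<not> paperfolding n"
proof -
  have "(n + 2 * q) mod 4 = 3 \<longleftrightarrow> n mod 4 \<noteq> 3"
    using assms by presburger
  then show ?thesis
    using assms by (simp add: paperfolding_odd)
qed

lemma paperfolding_square_halve:
  assumes "block paperfolding a (2 * q) = block paperfolding (a + 2 * q) (2 * q)"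
  shows "block paperfolding ((a + 1) div 2) q = block paperfolding ((a + 1) div 2 + q) q"
  unfolding block_eq_iff
proof (intro allI impI)
  fix i
  assume "i < q"
  let ?n = "(a + 1) div 2 + i"
  define j where "j = 2 * ?n - a"
  have j: "a + j = 2 * ?n" "a + 2 * q + j = 2 * (?n + q)" "j < 2 * q"
    using \<open>i < q\<close> by (auto simp: j_def)
  have "paperfolding (2 * ?n) = paperfolding (2 * (?n + q))"
    using assms j unfolding block_eq_iff by metis
  then show "paperfolding ?n = paperfolding ((a + 1) div 2 + q + i)"
    by (simp only: paperfolding_double ac_simps)
qed

lemma paperfolding_no_even_square:
  assumes "even p" and "p > 0"
  shows "block paperfolding a p \<noteq> block paperfolding (a + p) p"
  using assms
proof (induction p arbitrary: a rule: less_induct)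
  case (less p)
  obtain q where q: "p = 2 * q" using less.prems by (elim evenE)
  show ?case
  proof (cases "even q")
    case True
    then show ?thesis
      using less.IH[of q "(a + 1) div 2"] less.prems paperfolding_square_halve[of a q] q by auto
  next
    case False
    obtain i where i: "i < 2" "odd (a + i)"
      by (cases "even a") (auto intro: that[of 0] that[of 1])
    then have "paperfolding (a + p + i) \<noteq> paperfolding (a + i)"
      using paperfolding_add_double_odd[of "a + i" q] False by (simp add: q ac_simps)
    moreover have "i < p"
      using i less.prems q by simp
    ultimately show ?thesis
      by (auto simp: block_eq_iff)
  qed
qed

lemma paperfolding_no_even_fourth_power:
  assumes "even p" and "p > 0"
  shows "\<exists>i<4. \<not> block paperfolding a p \<simeq> block paperfolding (a + i * p) p"
proof (rule ccontr)
  let ?B = "\<lambda>i. block paperfolding (a + i * p) p"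
  assume "\<not> ?thesis"
  then have equiv: "?B i \<in> {?B 0, rev (?B 0)}" if "i < 4" for i
    using that by (auto simp: rev_equiv_def)
  have neq: "?B i \<noteq> ?B (Suc i)" for i
    using paperfolding_no_even_square[OF assms, of "a + i * p"] by (simp add: ac_simps)
  have "?B 0 = ?B 2" "?B 1 = ?B 3"
    using equiv[of 1] equiv[of 2] equiv[of 3] neq[of 0] neq[of 1] neq[of 2]
    by (auto simp: numeral_eq_Suc)
  then have "block paperfolding a (2 * p) = block paperfolding (a + 2 * p) (2 * p)"
    by (simp add: mult_2 block_add add.assoc numeral_eq_Suc)
  then show False
    using paperfolding_no_even_square[of "2 * p" a] assms by simp
qed

lemma paperfolding_no_odd_fourth_power:
  assumes "odd p"
  shows "\<exists>i<4. \<not> block paperfolding a p \<simeq> block paperfolding (a + i * p) p"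
proof (rule ccontr)
  assume contra: "\<not> ?thesis"
  obtain m where m: "p = 2 * m + 1" using assms by (elim oddE)
  have middle: "paperfolding (a + m + i * p) = paperfolding (a + m)" if "i < 4" for i
  proof -
    have "block paperfolding a p ! m = block paperfolding (a + i * p) p ! m"
      using contra that by (intro rev_equiv_nth_middle) (auto simp: m)
    then show ?thesis by (simp add: m ac_simps)
  qed
  obtain i where i: "i < 2" "odd (a + m + i * p)"
    using assms by (cases "even (a + m)") (auto intro: that[of 0] that[of 1])
  moreover have "a + m + (i + 2) * p = a + m + i * p + 2 * p"
    by (simp add: algebra_simps)
  ultimately have "paperfolding (a + m + (i + 2) * p) \<noteq> paperfolding (a + m + i * p)"
    using paperfolding_add_double_odd[of "a + m + i * p" p] assms by metis
  then show False
    using middle[of i] middle[of "i + 2"] i by simp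
qed

theorem paperfolding_avoids_fourth_power: "avoids paperfolding (replicate 4 x)"
  unfolding avoids_def encounters_replicate_iff
  using paperfolding_no_even_fourth_power paperfolding_no_odd_fourth_power by blast

corollary avoidable_2_fourth_power: "avoidable 2 (replicate 4 x)"
  using avoidable_card_iff[of "UNIV :: bool set" "replicate 4 x"]
    paperfolding_avoids_fourth_power[of x] by auto


section \<open>The avoidability index of unary patterns\<close>

theorem theorem3:
  fixes k :: nat and x :: 'v
  assumes "k \<ge> 2"
  shows "(k \<in> {2, 3} \<longrightarrow> avoidability_index (replicate k x) = 3)
       \<and> (k \<ge> 4 \<longrightarrow> avoidability_index (replicate k x) = 2)"
proof (intro conjI impI)
  assume "k \<in> {2, 3}"
  then have "k \<le> 3" by auto
  have "avoidable 3 (replicate k x)"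
    using avoidable_3_square assms by (rule avoidable_replicate_mono)
  moreover have "\<not> avoidable 2 (replicate k x)"
    using avoidable_replicate_mono[OF _ \<open>k \<le> 3\<close>, of 2 x] not_avoidable_2_cube[of x] by blast
  ultimately show "avoidability_index (replicate k x) = 3"
    using avoidability_index_eqI[of 2] by (simp add: numeral_eq_enat)
next
  assume "k \<ge> 4"
  with avoidable_2_fourth_power have "avoidable 2 (replicate k x)"
    by (rule avoidable_replicate_mono)
  then show "avoidability_index (replicate k x) = 2"
    using avoidability_index_eqI[OF _ not_avoidable_1, of "replicate k x"]
    by (simp add: numeral_eq_enat numeral_2_eq_2)
qed

end
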